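(* Let $n\ge1$. A skew brace $A$ belongs to $\mathcal I_n$ if and only if $\epsilon(u,v)\in\mathrm{Ann}_{n-r}(A)$ for all $\epsilon\in X$, all integers $r$ with $1\le r\le n$, all $u\in\mathrm{Ann}_n(A)$ and all $v\in S_{r-1}(A)$.
   Context: A skew (left) brace is a set $A$ with two group structures $(A,\cdot)$, $(A,\circ)$ such that $a\circ(b\cdot c)=(a\circ b)\cdot a^{-1}\cdot(a\circ c)$ for all $a,b,c$, where $a^{-1}$ is the inverse in $(A,\cdot)$. The two identities coincide, denoted $1$. Put $\lambda_a(b)=a^{-1}\cdot(a\circ b)$, $a*b=\lambda_a(b)\cdot b^{-1}$, $[a,b]^{\cdot}=a\cdot b\cdot a^{-1}\cdot b^{-1}$. Annihilator series: $\mathrm{Ann}_0(A)=1$, $\mathrm{Ann}(A)=\mathrm{Ann}_1(A)=\{a: a*b=b*a=[a,b]^{\cdot}=1\ \forall b\in A\}$, $\mathrm{Ann}_n(A)/\mathrm{Ann}_{n-1}(A)=\mathrm{Ann}(A/\mathrm{Ann}_{n-1}(A))$; these are ideals of $A$ (subgroups of $(A,\cdot)$ stable under all $\lambda_a$ and normal in both groups). Commutator words: $M$ is the free monoid on the four symbols $X=\{\gamma,\bar\gamma,*,\bar *\}$, where $\gamma(a,b)=[a,b]^{\cdot}$, $\bar\gamma(a,b)=[b,a]^{\cdot}$, $*(a,b)=a*b$, $\bar *(a,b)=b*a$. For $m=\epsilon_1\cdots\epsilon_s\in M$ ($\epsilon_i\in X$), $\deg(m)=s$ and $m(a_1a_2\cdots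 a_{s+1})=\epsilon_1(a_1,\epsilon_2(a_2,\ldots,\epsilon_s(a_s,a_{s+1})\cdots))$. $S_0(A)=A$ and, for $r\ge1$, $S_r(A)=\{m(a_1\cdots a_{r+1}): m\in M,\ \deg(m)=r,\ a_i\in A\}$. $A_{(t)}$ is the subgroup of $(A,\cdot)$ generated by all values $m(a_1\cdots a_{\deg(m)+1})$ with $m\in M$, $\deg(m)\ge t$, $a_i\in A$. $\mathcal I_n$ is the class of skew braces $A$ such that for every $m\in M$ with $\deg(m)=n$ the map $\phi^A_m:(A/\mathrm{Ann}_n(A))^{n+1}\to A_{(n)}$, $(\mathrm{Ann}_n(A)a_1,\ldots,\mathrm{Ann}_n(A)a_{n+1})\mapsto m(a_1\cdots a_{n+1})$, is well defined. *)

theory Defs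
  imports "HOL-Algebra.Generated_Groups"
begin

section \<open>Skew braces\<close>

text \<open>
  The inherited monoid fields carry the structure written \<open>\<cdot>\<close>; the two new fields carry the
  second structure \<open>\<circ>\<close> on the same carrier.  Its identity is a separate field, so that the
  coincidence of the two identities is a consequence of the axioms and not part of them.
\<close>

record 'a skew_brace = "'a monoid" +
  circ :: "'a \<Rightarrow> 'a \<Rightarrow> 'a"
  circ_one :: 'a

definition circ_monoid :: "('a, 'm) skew_brace_scheme \<Rightarrow> 'a monoid" where
  "circ_monoid A = \<lparr>carrier = carrier A, mult = circ A, one = circ_one A\<rparr>"

locale skew_brace = group A + circ: group "circ_monoid A"
  for A :: "('a, 'm) skew_brace_scheme" (structure) +
  assumes circ_mult_distrib:
    "\<lbrakk>a \<in> carrier A; b \<in> carrier A; c \<in> carrier A\<rbrakk> \<Longrightarrow>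
       circ A a (b \<otimes> c) = circ A a b \<otimes> inv a \<otimes> circ A a c"

definition brace_lambda :: "('a, 'm) skew_brace_scheme \<Rightarrow> 'a \<Rightarrow> 'a \<Rightarrow> 'a" where
  "brace_lambda A a b = inv\<^bsub>A\<^esub> a \<otimes>\<^bsub>A\<^esub> circ A a b"

definition brace_star :: "('a, 'm) skew_brace_scheme \<Rightarrow> 'a \<Rightarrow> 'a \<Rightarrow> 'a" where
  "brace_star A a b = brace_lambda A a b \<otimes>\<^bsub>A\<^esub> inv\<^bsub>A\<^esub> b"

definition dot_comm :: "('a, 'm) skew_brace_scheme \<Rightarrow> 'a \<Rightarrow> 'a \<Rightarrow> 'a" where
  "dot_comm A a b = a \<otimes>\<^bsub>A\<^esub> b \<otimes>\<^bsub>A\<^esub> inv\<^bsub>A\<^esub> a \<otimes>\<^bsub>A\<^esub> inv\<^bsub>A\<^esub> b"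

section \<open>Quotients and the annihilator series\<close>

text \<open>
  The quotient is meant for an ideal \<open>I\<close>.  Then the cosets of \<open>I\<close> for the two group structures
  coincide, so a single carrier serves both, and both operations are products of subsets.
\<close>

definition brace_quotient :: "('a, 'm) skew_brace_scheme \<Rightarrow> 'a set \<Rightarrow> 'a set skew_brace" where
  "brace_quotient A I =
     \<lparr>carrier = rcosets\<^bsub>A\<^esub> I, mult = set_mult A, one = I,
      circ = set_mult (circ_monoid A), circ_one = I\<rparr>"

definition annihilator :: "('a, 'm) skew_brace_scheme \<Rightarrow> 'a set" where
  "annihilator A =
     {a \<in> carrier A. \<forall>b \<in> carrier A.
        brace_star A a b = \<one>\<^bsub>A\<^esub> \<and> brace_star A b a = \<one>\<^bsub>A\<^esub> \<and> dot_comm A a b = \<one>\<^bsub>A\<^esub>}"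

text \<open>
  The equation \<open>Ann\<^sub>n(A) / Ann\<^sub>n\<^sub>-\<^sub>1(A) = Ann(A / Ann\<^sub>n\<^sub>-\<^sub>1(A))\<close> is read as: \<open>Ann\<^sub>n(A)\<close> is the full
  preimage of the right-hand side under the projection.
\<close>

primrec Ann :: "('a, 'm) skew_brace_scheme \<Rightarrow> nat \<Rightarrow> 'a set" where
  "Ann A 0 = {\<one>\<^bsub>A\<^esub>}"
| "Ann A (Suc n) = {a \<in> carrier A. Ann A n #>\<^bsub>A\<^esub> a \<in> annihilator (brace_quotient A (Ann A n))}"

section \<open>Commutator words\<close>

datatype comm_symbol = Gamma | Gamma_bar | Star | Star_bar

primrec apply_symbol ::
  "('a, 'm) skew_brace_scheme \<Rightarrow> comm_symbol \<Rightarrow> 'a \<Rightarrow> 'a \<Rightarrow> 'a" where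
  "apply_symbol A Gamma a b = dot_comm A a b"
| "apply_symbol A Gamma_bar a b = dot_comm A b a"
| "apply_symbol A Star a b = brace_star A a b"
| "apply_symbol A Star_bar a b = brace_star A b a"

text \<open>
  Words, the elements of the free monoid on the symbols, are lists, and the degree is the length.
  \<open>word_value A m as\<close> is only meant for \<open>length as = length m + 1\<close>; the empty word returns its
  single argument.
\<close>

primrec word_value ::
  "('a, 'm) skew_brace_scheme \<Rightarrow> comm_symbol list \<Rightarrow> 'a list \<Rightarrow> 'a" where
  "word_value A [] as = hd as"
| "word_value A (e # m) as = apply_symbol A e (hd as) (word_value A m (tl as))"

primrec word_values :: "('a, 'm) skew_brace_scheme \<Rightarrow> nat \<Rightarrow> 'a set" where
  "word_values A 0 = carrier A"
| "word_values A (Suc r) =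
     {word_value A m as | m as.
        length m = Suc r \<and> length as = length m + 1 \<and> set as \<subseteq> carrier A}"

definition word_subgroup :: "('a, 'm) skew_brace_scheme \<Rightarrow> nat \<Rightarrow> 'a set" where
  "word_subgroup A t =
     generate A {word_value A m as | m as.
        t \<le> length m \<and> length as = length m + 1 \<and> set as \<subseteq> carrier A}"

text \<open>
  Well-definedness of \<open>\<phi>\<^sub>m\<close> is the existence of a map on tuples of cosets, with values in
  \<open>A\<^sub>(\<^sub>n\<^sub>)\<close>, satisfying the defining formula for every choice of representatives.
\<close>

definition phi_well_defined ::
  "('a, 'm) skew_brace_scheme \<Rightarrow> nat \<Rightarrow> comm_symbol list \<Rightarrow> bool" where
  "phi_well_defined A n m \<longleftrightarrow>
     (\<exists>\<phi> \<in> {cs. length cs = n + 1 \<and> set cs \<subseteq> carrier (brace_quotient A (Ann A n))}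
             \<rightarrow> word_subgroup A n.
        \<forall>as. length as = n + 1 \<and> set as \<subseteq> carrier A \<longrightarrow>
          \<phi> (map (\<lambda>a. Ann A n #>\<^bsub>A\<^esub> a) as) = word_value A m as)"

definition class_I :: "nat \<Rightarrow> ('a, 'm) skew_brace_scheme \<Rightarrow> bool" where
  "class_I n A \<longleftrightarrow> skew_brace A \<and> (\<forall>m. length m = n \<longrightarrow> phi_well_defined A n m)"

end

theory Submission
  imports Defs
begin

text \<open>
  Write \<open>a \<equiv> b\<close> modulo an ideal \<open>I\<close> for equality of the cosets of \<open>a\<close> and \<open>b\<close>.  Everything rests on two
  descriptions of the annihilator series.  Recursively, \<open>u \<in> Ann (k + 1)\<close> iff \<open>\<epsilon>(u, b) \<in> Ann k\<close> for
  all symbols \<open>\<epsilon>\<close> and all \<open>b\<close> (\<open>mem_Ann_Suc_iff\<close>).  Since the symbols are closed under exchanging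
  their two arguments, unfolding this recursion shows that \<open>x \<in> Ann k\<close> iff every word of degree
  \<open>k\<close> with last argument \<open>x\<close> has value \<open>1\<close> (\<open>mem_Ann_iff_words\<close>).

  If the maps \<open>\<phi>\<^sub>m\<close> are well defined, let \<open>u \<in> Ann n\<close> and \<open>v = m'(b\<^sub>1 \<dots> b\<^sub>r)\<close> with
  \<open>deg m' = r - 1\<close>.  For every word \<open>m\<close> of degree \<open>n - r\<close> the element \<open>m(\<dots> \<epsilon>(u, v))\<close> is a
  value of the word \<open>m \<epsilon> m'\<close> of degree \<open>n\<close>, with \<open>u\<close> as one of the arguments.  Replacing \<open>u\<close> by \<open>1\<close>
  does not change it, and gives \<open>m(\<dots> 1) = 1\<close>.  So \<open>\<epsilon>(u, v) \<in> Ann (n - r)\<close> by the description by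
  words.

  Conversely, by induction on the degree \<open>j \<le> n\<close>, a word of degree \<open>j\<close> takes congruent values modulo
  \<open>Ann (n - j)\<close> on tuples that agree modulo \<open>Ann n\<close> (\<open>word_value_cong\<close>); at \<open>j = n\<close> the values are
  equal.  In the step, the value \<open>\<epsilon>(a, v)\<close> is changed in two stages.  Replacing \<open>a\<close> by \<open>a' \<equiv> a\<close>
  modulo \<open>Ann n\<close> is harmless by the hypothesis on \<open>\<epsilon>(u, v)\<close>, and replacing \<open>v\<close> by \<open>v' \<equiv> v\<close> modulo
  \<open>Ann (n - j)\<close> loses one step of the annihilator series.  Both stages are instances of one fact
  (\<open>apply_symbol_coset_cong\<close>): if all \<open>\<epsilon>(u, v)\<close> with \<open>u\<close> in an ideal \<open>K\<close> lie in an ideal \<open>I\<close>, then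
  modulo \<open>I\<close> the element \<open>\<epsilon>(a, v)\<close> depends only on the coset of \<open>a\<close> modulo \<open>K\<close>.
\<close>

section \<open>Elementary identities in a skew brace\<close>

lemma circ_monoid_simps [simp]:
  "carrier (circ_monoid A) = carrier A" "mult (circ_monoid A) = circ A" "one (circ_monoid A) = circ_one A"
  by (simp_all add: circ_monoid_def)

lemma (in group) inv_mult_cancel_left:
  "\<lbrakk>x \<in> carrier G; y \<in> carrier G\<rbrakk> \<Longrightarrow> inv x \<otimes> (x \<otimes> y) = y"
  and mult_inv_cancel_left:
  "\<lbrakk>x \<in> carrier G; y \<in> carrier G\<rbrakk> \<Longrightarrow> x \<otimes> (inv x \<otimes> y) = y"
  by (simp_all add: m_assoc[symmetric])

context skew_brace
begin

lemma circ_closed [simp, intro]: "\<lbrakk>a \<in> carrier A; b \<in> carrier A\<rbrakk> \<Longrightarrow> circ A a b \<in> carrier A"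
  using circ.m_closed by simp

lemma circ_assoc:
  "\<lbrakk>a \<in> carrier A; b \<in> carrier A; c \<in> carrier A\<rbrakk> \<Longrightarrow> circ A (circ A a b) c = circ A a (circ A b c)"
  using circ.m_assoc by simp

text \<open>With \<open>a = e\<close> the identity of \<open>\<circ>\<close> and \<open>b = c = 1\<close>, the compatibility axiom reads \<open>1 = inv e\<close>.\<close>

lemma circ_one_eq_one: "circ_one A = \<one>"
proof -
  let ?e = "circ_one A"
  have e: "?e \<in> carrier A" using circ.one_closed by simp
  have "\<one> = circ A ?e (\<one> \<otimes> \<one>)" using circ.l_one[of \<one>] by simp
  also have "\<dots> = circ A ?e \<one> \<otimes> inv ?e \<otimes> circ A ?e \<one>"
    using e by (intro circ_mult_distrib) auto
  also have "\<dots> = inv ?e" using circ.l_one[of \<one>] e by simp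
  finally show ?thesis using e by (metis inv_inv inv_one)
qed

lemma circ_one_left [simp]: "a \<in> carrier A \<Longrightarrow> circ A \<one> a = a"
  and circ_one_right [simp]: "a \<in> carrier A \<Longrightarrow> circ A a \<one> = a"
  using circ.l_one[of a] circ.r_one[of a] by (simp_all add: circ_one_eq_one)

lemma brace_star_closed [simp, intro]:
  "\<lbrakk>a \<in> carrier A; b \<in> carrier A\<rbrakk> \<Longrightarrow> brace_star A a b \<in> carrier A"
  by (simp add: brace_star_def brace_lambda_def)

lemma dot_comm_closed [simp, intro]:
  "\<lbrakk>a \<in> carrier A; b \<in> carrier A\<rbrakk> \<Longrightarrow> dot_comm A a b \<in> carrier A"
  by (simp add: dot_comm_def)

lemma apply_symbol_closed [simp, intro]:
  "\<lbrakk>a \<in> carrier A; b \<in> carrier A\<rbrakk> \<Longrightarrow> apply_symbol A e a b \<in> carrier A"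
  by (cases e) auto

lemma brace_star_eq_one_iff:
  assumes "a \<in> carrier A" "b \<in> carrier A"
  shows "brace_star A a b = \<one> \<longleftrightarrow> circ A a b = a \<otimes> b"
proof -
  have "brace_star A a b = \<one> \<longleftrightarrow> inv a \<otimes> circ A a b = b"
    unfolding brace_star_def brace_lambda_def using assms
    by (metis circ_closed inv_closed inv_equality inv_inv m_closed r_inv)
  also have "\<dots> \<longleftrightarrow> circ A a b = a \<otimes> b"
    using assms by (metis circ_closed inv_solve_left)
  finally show ?thesis .
qed

lemma dot_comm_eq_one_iff:
  assumes "a \<in> carrier A" "b \<in> carrier A"
  shows "dot_comm A a b = \<one> \<longleftrightarrow> a \<otimes> b = b \<otimes> a"
proof -
  have "dot_comm A a b = (a \<otimes> b) \<otimes> inv (b \<otimes> a)"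
    using assms by (simp add: dot_comm_def inv_mult_group m_assoc)
  then show ?thesis
    using assms by (metis inv_closed inv_equality inv_inv m_closed r_inv)
qed

text \<open>
  Vanishing of all symbols at \<open>(u, v)\<close> says that the four products of \<open>u\<close> and \<open>v\<close>, in either order and
  for either operation, coincide; in this form it can be used for rewriting.
\<close>

definition symbols_vanish :: "'a \<Rightarrow> 'a \<Rightarrow> bool" where
  "symbols_vanish u v \<longleftrightarrow> (\<forall>e. apply_symbol A e u v = \<one>)"

lemma symbols_vanish_iff:
  assumes "u \<in> carrier A" "v \<in> carrier A"
  shows "symbols_vanish u v \<longleftrightarrow>
    u \<otimes> v = v \<otimes> u \<and> circ A u v = u \<otimes> v \<and> circ A v u = v \<otimes> u"
proof -
  have "symbols_vanish u v \<longleftrightarrow> dot_comm A u v = \<one> \<and> dot_comm A v u = \<one> \<and>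
      brace_star A u v = \<one> \<and> brace_star A v u = \<one>"
    unfolding symbols_vanish_def by (metis apply_symbol.simps comm_symbol.exhaust)
  then show ?thesis
    using assms by (auto simp: brace_star_eq_one_iff dot_comm_eq_one_iff)
qed

lemma apply_symbol_one_left [simp]: "v \<in> carrier A \<Longrightarrow> apply_symbol A e \<one> v = \<one>"
  using symbols_vanish_iff[of \<one> v] by (simp add: symbols_vanish_def)

text \<open>
  The next two lemmas absorb a factor \<open>u\<close> on the right of the first argument.  The factor has to be
  attached by \<open>\<cdot>\<close> for three of the symbols, but by \<open>\<circ>\<close> for the symbol \<open>*\<close>: as
  \<open>a \<cdot> u = a \<circ> u'\<close> with \<open>\<lambda>\<^sub>a(u') = u\<close>, expanding \<open>(a \<cdot> u) * v\<close> would bring in \<open>u' * v\<close> instead of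
  \<open>u * v\<close>, whereas \<open>(a \<circ> u) \<circ> v = a \<circ> (u \<cdot> v)\<close> brings \<open>u\<close> and \<open>v\<close> together.
\<close>

lemma apply_symbol_mult_vanishing:
  assumes "a \<in> carrier A" "u \<in> carrier A" "v \<in> carrier A" "symbols_vanish u v" "e \<noteq> Star"
  shows "apply_symbol A e (a \<otimes> u) v = apply_symbol A e a v"
proof -
  have uv: "u \<otimes> v = v \<otimes> u" "circ A v u = v \<otimes> u"
    using assms symbols_vanish_iff by auto
  have *: "a \<otimes> u \<otimes> v \<otimes> inv (a \<otimes> u) = a \<otimes> v \<otimes> inv a"
  proof -
    have "a \<otimes> u \<otimes> v \<otimes> inv (a \<otimes> u) = a \<otimes> (u \<otimes> v) \<otimes> (inv u \<otimes> inv a)"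
      using assms by (simp add: m_assoc inv_mult_group)
    also have "\<dots> = a \<otimes> v \<otimes> inv a"
      using assms unfolding uv by (simp add: m_assoc mult_inv_cancel_left)
    finally show ?thesis .
  qed
  have 1: "dot_comm A (a \<otimes> u) v = dot_comm A a v"
    using * by (simp add: dot_comm_def)
  have 2: "dot_comm A y x = inv (dot_comm A x y)" if "x \<in> carrier A" "y \<in> carrier A" for x y
    using that by (simp add: dot_comm_def inv_mult_group m_assoc)
  have 3: "brace_star A v (a \<otimes> u) = brace_star A v a"
  proof -
    have "brace_star A v (a \<otimes> u)
        = inv v \<otimes> (circ A v a \<otimes> inv v \<otimes> (v \<otimes> u)) \<otimes> inv (a \<otimes> u)"
      using assms by (simp add: brace_star_def brace_lambda_def circ_mult_distrib uv)
    also have "\<dots> = inv v \<otimes> circ A v a \<otimes> inv a"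
      using assms by (simp add: m_assoc inv_mult_group inv_mult_cancel_left mult_inv_cancel_left)
    finally show ?thesis by (simp add: brace_star_def brace_lambda_def)
  qed
  show ?thesis
    using assms 1 2[of "a \<otimes> u" v] 2[of a v] 3 by (cases e) auto
qed

lemma brace_star_circ_vanishing:
  assumes "a \<in> carrier A" "u \<in> carrier A" "v \<in> carrier A" "symbols_vanish u v"
  shows "brace_star A (circ A a u) v = brace_star A a v"
proof -
  have uv: "circ A u v = u \<otimes> v" using assms symbols_vanish_iff by auto
  have "circ A (circ A a u) v = circ A a u \<otimes> inv a \<otimes> circ A a v"
    using assms by (simp add: circ_assoc uv circ_mult_distrib)
  then show ?thesis
    using assms by (simp add: brace_star_def brace_lambda_def m_assoc inv_mult_cancel_left)
qed

end

section \<open>Ideals and the annihilator\<close>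

text \<open>
  Stability under all \<open>\<lambda>\<^sub>a\<close> is expressed by the equality of the cosets of \<open>I\<close> for the two operations.
  Given normality for both operations this is equivalent, because \<open>\<lambda>\<^sub>a(I) = I\<close> means
  \<open>a \<circ> I = a \<cdot> I\<close>.  It is the form that makes the quotient a skew brace.
\<close>

definition brace_ideal :: "('a, 'm) skew_brace_scheme \<Rightarrow> 'a set \<Rightarrow> bool" where
  "brace_ideal A I \<longleftrightarrow> I \<lhd> A \<and> I \<lhd> circ_monoid A \<and>
     (\<forall>a \<in> carrier A. I #>\<^bsub>circ_monoid A\<^esub> a = I #>\<^bsub>A\<^esub> a)"

context skew_brace
begin

lemma mem_annihilator_iff:
  "z \<in> annihilator A \<longleftrightarrow> z \<in> carrier A \<and> (\<forall>b \<in> carrier A. symbols_vanish z b)"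
  by (auto simp: annihilator_def symbols_vanish_iff brace_star_eq_one_iff dot_comm_eq_one_iff)

lemma one_in_annihilator: "\<one> \<in> annihilator A"
  by (simp add: mem_annihilator_iff symbols_vanish_def)

lemma annihilatorD:
  assumes "z \<in> annihilator A" 
  shows "z \<in> carrier A"
    and "b \<in> carrier A \<Longrightarrow> circ A z b = z \<otimes> b"
    and "b \<in> carrier A \<Longrightarrow> circ A b z = z \<otimes> b"
    and "b \<in> carrier A \<Longrightarrow> b \<otimes> z = z \<otimes> b"
  using assms mem_annihilator_iff[of z] symbols_vanish_iff[of z b] by auto

lemma annihilatorI:
  assumes "z \<in> carrier A" 
    and "\<And>b. b \<in> carrier A \<Longrightarrow> b \<otimes> z = z \<otimes> b"
    and "\<And>b. b \<in> carrier A \<Longrightarrow> circ A z b = z \<otimes> b"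
    and "\<And>b. b \<in> carrier A \<Longrightarrow> circ A b z = z \<otimes> b"
  shows "z \<in> annihilator A"
  using assms mem_annihilator_iff[of z] symbols_vanish_iff[of z] by auto

text \<open>
  For the closure properties, a product with an annihilator element may be computed with either
  operation and in either order, so associativity of \<open>\<circ>\<close> can be played off against that of \<open>\<cdot>\<close>.
\<close>

lemma annihilator_mult_closed:
  assumes y: "y \<in> annihilator A" and z: "z \<in> annihilator A"
  shows "y \<otimes> z \<in> annihilator A"
proof (rule annihilatorI)
  note [simp] = annihilatorD(1)[OF y] annihilatorD(1)[OF z]
  have yz: "y \<otimes> z = circ A y z" by (simp add: annihilatorD(2)[OF y])
  show "y \<otimes> z \<in> carrier A" by simp
  fix b assume b [simp]: "b \<in> carrier A"
  have zb: "z \<otimes> (y \<otimes> b) = y \<otimes> z \<otimes> b"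
    by (simp add: annihilatorD(4)[OF z] m_assoc[symmetric])
  have "b \<otimes> (y \<otimes> z) = z \<otimes> (b \<otimes> y)"
    by (simp add: annihilatorD(4)[OF z] m_assoc[symmetric])
  then show "b \<otimes> (y \<otimes> z) = y \<otimes> z \<otimes> b"
    by (simp add: annihilatorD(4)[OF y] zb)
  have "circ A (y \<otimes> z) b = circ A y (circ A z b)" by (simp add: yz circ_assoc)
  then show "circ A (y \<otimes> z) b = y \<otimes> z \<otimes> b"
    by (simp add: annihilatorD(2)[OF y] annihilatorD(2)[OF z] m_assoc)
  have "circ A b (y \<otimes> z) = circ A (circ A b y) z" by (simp add: yz circ_assoc)
  then show "circ A b (y \<otimes> z) = y \<otimes> z \<otimes> b"
    by (simp add: annihilatorD(3)[OF y] annihilatorD(3)[OF z] zb)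
qed

lemma annihilator_inv_closed:
  assumes z: "z \<in> annihilator A"
  shows "inv z \<in> annihilator A"
proof (rule annihilatorI)
  note zc [simp] = annihilatorD(1)[OF z]
  have z_inv: "circ A z (inv z) = \<one>" "circ A (inv z) z = \<one>"
    by (simp_all add: annihilatorD(2,3)[OF z])
  show "inv z \<in> carrier A" by simp
  fix b assume b [simp]: "b \<in> carrier A"
  show "b \<otimes> inv z = inv z \<otimes> b"
    using annihilatorD(4)[OF z, of "inv z \<otimes> b"]
    by (metis b inv_closed inv_solve_right mult_inv_cancel_left m_closed zc)
  have "z \<otimes> circ A (inv z) b = b"
    using annihilatorD(2)[OF z, of "circ A (inv z) b"] circ_assoc[of z "inv z" b] z_inv by simp
  then show "circ A (inv z) b = inv z \<otimes> b" by (simp add: inv_solve_left)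
  have "z \<otimes> circ A b (inv z) = b"
    using annihilatorD(3)[OF z, of "circ A b (inv z)"] circ_assoc[of b "inv z" z] z_inv by simp
  then show "circ A b (inv z) = inv z \<otimes> b" by (simp add: inv_solve_left)
qed

lemma annihilator_subgroup: "subgroup (annihilator A) A"
  by (rule subgroup.intro)
    (auto simp: annihilatorD(1) annihilator_mult_closed annihilator_inv_closed one_in_annihilator)

lemma circ_inv_annihilator:
  assumes z: "z \<in> annihilator A"
  shows "inv\<^bsub>circ_monoid A\<^esub> z = inv z"
  by (rule circ.inv_equality) (simp_all add: annihilatorD(1,2,3)[OF z] circ_one_eq_one)

lemma annihilator_ideal: "brace_ideal A (annihilator A)"
  unfolding brace_ideal_def
proof (intro conjI ballI)
  show "annihilator A \<lhd> A"
  proof (rule normal_invI[OF annihilator_subgroup])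
    fix x z assume x: "x \<in> carrier A" and z: "z \<in> annihilator A"
    have "x \<otimes> z \<otimes> inv x = z"
      using x annihilatorD(1)[OF z] by (simp add: annihilatorD(4)[OF z] m_assoc)
    then show "x \<otimes> z \<otimes> inv x \<in> annihilator A" using z by simp
  qed
  have "subgroup (annihilator A) (circ_monoid A)"
    by (rule subgroup.intro)
      (auto simp: annihilatorD(1,2) annihilator_mult_closed circ_inv_annihilator
        annihilator_inv_closed one_in_annihilator circ_one_eq_one)
  then show "annihilator A \<lhd> circ_monoid A"
  proof (rule circ.normal_invI)
    fix x z assume x: "x \<in> carrier (circ_monoid A)" and z: "z \<in> annihilator A"
    have "circ A x z = circ A z x" using x by (simp add: annihilatorD(2,3)[OF z])
    then show "x \<otimes>\<^bsub>circ_monoid A\<^esub> z \<otimes>\<^bsub>circ_monoid A\<^esub> inv\<^bsub>circ_monoid A\<^esub> x \<in> annihilator A"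
      using circ.inv_closed[OF x] circ.r_inv[OF x] x annihilatorD(1)[OF z] z
      by (simp add: circ_assoc circ_one_eq_one)
  qed
  fix a assume "a \<in> carrier A"
  then show "annihilator A #>\<^bsub>circ_monoid A\<^esub> a = annihilator A #> a"
    by (auto simp: r_coset_def annihilatorD(2))
qed

end

section \<open>Quotients by ideals\<close>

lemma (in group_hom) normal_preimage:
  assumes "N \<lhd> H"
  shows "{x \<in> carrier G. h x \<in> N} \<lhd> G"
proof (rule G.normal_invI)
  interpret N: normal N H by fact
  show "subgroup {x \<in> carrier G. h x \<in> N} G"
    by (rule subgroup.intro) auto
  fix x k assume "x \<in> carrier G" "k \<in> {x \<in> carrier G. h x \<in> N}"
  then show "x \<otimes> k \<otimes> inv x \<in> {x \<in> carrier G. h x \<in> N}"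
    by (auto simp: N.inv_op_closed2)
qed

lemma (in group_hom) r_coset_preimage:
  assumes "N \<subseteq> carrier H" "a \<in> carrier G"
  shows "{x \<in> carrier G. h x \<in> N} #> a = {x \<in> carrier G. h x \<in> N #>\<^bsub>H\<^esub> h a}" (is "?L = ?R")
proof
  show "?L \<subseteq> ?R" using assms by (auto simp: r_coset_def)
  show "?R \<subseteq> ?L"
  proof
    fix x assume "x \<in> ?R"
    then obtain z where x: "x \<in> carrier G" and z: "z \<in> N" "h x = z \<otimes>\<^bsub>H\<^esub> h a"
      by (auto simp: r_coset_def)
    then have "h (x \<otimes> inv a) = z"
      using assms x by (auto simp: H.m_assoc subset_iff)
    moreover have "x = x \<otimes> inv a \<otimes> a" using x assms by (simp add: G.m_assoc)
    ultimately show "x \<in> ?L"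
      unfolding r_coset_def using x z(1) assms(2)
      by (intro UN_I[of "x \<otimes> inv a"]) auto
  qed
qed


locale skew_brace_ideal = skew_brace +
  fixes I
  assumes ideal: "brace_ideal A I"
begin

sublocale normal I A using ideal by (simp add: brace_ideal_def)

sublocale circ_normal: normal I "circ_monoid A" using ideal by (simp add: brace_ideal_def)

abbreviation quot :: "'a set skew_brace" where "quot \<equiv> brace_quotient A I"

lemma circ_coset_eq: "a \<in> carrier A \<Longrightarrow> I #>\<^bsub>circ_monoid A\<^esub> a = I #> a"
  using ideal by (simp add: brace_ideal_def)

lemma carrier_quot: "carrier quot = (\<lambda>a. I #> a) ` carrier A"
  by (auto simp: brace_quotient_def RCOSETS_def)

lemma one_quot: "\<one>\<^bsub>quot\<^esub> = I"
  by (simp add: brace_quotient_def)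

lemma mult_quot:
  "\<lbrakk>a \<in> carrier A; b \<in> carrier A\<rbrakk> \<Longrightarrow> (I #> a) \<otimes>\<^bsub>quot\<^esub> (I #> b) = I #> (a \<otimes> b)"
  by (simp add: brace_quotient_def rcos_sum)

lemma circ_quot:
  "\<lbrakk>a \<in> carrier A; b \<in> carrier A\<rbrakk> \<Longrightarrow> circ quot (I #> a) (I #> b) = I #> circ A a b"
  using circ_normal.rcos_sum[of a b] by (simp add: brace_quotient_def circ_coset_eq)

text \<open>
  As the cosets for the two operations coincide, both group structures of the quotient are ordinary
  factor groups.
\<close>

lemma circ_monoid_quot: "circ_monoid quot = circ_monoid A Mod I"
  by (auto simp: circ_monoid_def[of quot] brace_quotient_def FactGroup_def RCOSETS_def
      circ_coset_eq)

lemma group_quot: "group quot"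
proof -
  have "group (A Mod I)" by (rule factorgroup_is_group)
  then show ?thesis
    by (simp add: group_def monoid_def group_axioms_def Units_def brace_quotient_def FactGroup_def)
qed

lemma inv_quot: "a \<in> carrier A \<Longrightarrow> inv\<^bsub>quot\<^esub> (I #> a) = I #> inv a"
  by (rule group.inv_equality[OF group_quot])
    (auto simp: mult_quot one_quot carrier_quot coset_join2 subgroup_axioms)

lemma skew_brace_quot: "skew_brace quot"
proof -
  interpret Q: group quot by (rule group_quot)
  interpret Qc: group "circ_monoid quot"
    unfolding circ_monoid_quot by (rule circ_normal.factorgroup_is_group)
  show ?thesis
    by unfold_locales
      (auto simp: carrier_quot mult_quot circ_quot inv_quot circ_mult_distrib)
qed

sublocale Q: skew_brace quot by (rule skew_brace_quot)

lemma proj_hom: "group_hom A quot (\<lambda>a. I #> a)"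
  by unfold_locales (auto simp: hom_def carrier_quot mult_quot)

lemma circ_proj_hom: "group_hom (circ_monoid A) (circ_monoid quot) (\<lambda>a. I #> a)"
  by unfold_locales (auto simp: hom_def carrier_quot circ_quot)

lemma proj_closed [simp, intro]: "a \<in> carrier A \<Longrightarrow> I #> a \<in> carrier quot"
  by (simp add: carrier_quot)

lemma apply_symbol_quot:
  "\<lbrakk>a \<in> carrier A; b \<in> carrier A\<rbrakk> \<Longrightarrow>
     apply_symbol quot e (I #> a) (I #> b) = I #> apply_symbol A e a b"
  by (cases e)
    (auto simp: dot_comm_def brace_star_def brace_lambda_def mult_quot circ_quot inv_quot)

lemma proj_eq_one_iff: "a \<in> carrier A \<Longrightarrow> I #> a = \<one>\<^bsub>quot\<^esub> \<longleftrightarrow> a \<in> I"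
  unfolding one_quot by (metis coset_join1 coset_join2 subgroup_axioms subset)

lemma quot_symbols_vanish_iff:
  "\<lbrakk>u \<in> carrier A; v \<in> carrier A\<rbrakk> \<Longrightarrow>
     Q.symbols_vanish (I #> u) (I #> v) \<longleftrightarrow> (\<forall>e. apply_symbol A e u v \<in> I)"
  by (simp add: Q.symbols_vanish_def apply_symbol_quot proj_eq_one_iff)

text \<open>
  This carries ideals of the quotient back to \<open>A\<close>.  Applied to the annihilator of the quotient, it is
  the induction step showing that the annihilator series consists of ideals.
\<close>

lemma ideal_preimage:
  assumes "brace_ideal quot J"
  shows "brace_ideal A {a \<in> carrier A. I #> a \<in> J}"
proof -
  interpret J: skew_brace_ideal quot J using assms by unfold_locales
  interpret h: group_hom A quot "\<lambda>a. I #> a" by (rule proj_hom)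
  interpret hc: group_hom "circ_monoid A" "circ_monoid quot" "\<lambda>a. I #> a" by (rule circ_proj_hom)
  show ?thesis
    unfolding brace_ideal_def
    using h.normal_preimage[OF J.normal_axioms] hc.normal_preimage[OF J.circ_normal.normal_axioms]
      h.r_coset_preimage[OF J.subset] hc.r_coset_preimage[OF J.circ_normal.subset]
      J.circ_coset_eq
    by auto
qed

text \<open>
  The coset of \<open>a\<close> modulo \<open>K\<close> can be written both as \<open>a \<cdot> K\<close> and as \<open>a \<circ> K\<close>.  So \<open>a'\<close> arises from \<open>a\<close> by a
  factor from \<open>K\<close> attached with whichever operation suits the symbol, and in the quotient by \<open>I\<close> this
  factor is absorbed.  Only the one element \<open>v\<close> enters the hypothesis, so that \<open>K\<close> may be much larger
  than the preimage of the annihilator of \<open>A / I\<close>.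
\<close>

lemma apply_symbol_coset_cong:
  assumes K: "brace_ideal A K"
    and a: "a \<in> carrier A" "a' \<in> carrier A" "K #> a = K #> a'" and v: "v \<in> carrier A"
    and vanish: "\<And>e u. u \<in> K \<Longrightarrow> apply_symbol A e u v \<in> I"
  shows "I #> apply_symbol A e a v = I #> apply_symbol A e a' v"
proof -
  interpret K: skew_brace_ideal A K using K by unfold_locales
  have van: "Q.symbols_vanish (I #> u) (I #> v)" if "u \<in> K" for u
    using that v vanish quot_symbols_vanish_iff K.subset by auto
  have a': "a' \<in> K #> a"
    using rcos_self[OF a(2) K.subgroup_axioms] a(3) by simp
  show ?thesis
  proof (cases "e = Star")
    case True
    have "a' \<in> a <#\<^bsub>circ_monoid A\<^esub> K"
      using a' a(1) K.circ_normal.coset_eq K.circ_coset_eq by simp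
    then obtain u where u: "u \<in> K" "a' = circ A a u" by (auto simp: l_coset_def)
    then have uc: "u \<in> carrier A" using K.subset by auto
    have "brace_star quot (circ quot (I #> a) (I #> u)) (I #> v) = brace_star quot (I #> a) (I #> v)"
      using a uc v van[OF u(1)] by (intro Q.brace_star_circ_vanishing) auto
    then show ?thesis
      using True a uc v u apply_symbol_quot[of _ v Star] by (simp add: circ_quot)
  next
    case False
    have "a' \<in> a <# K"
      using a' a(1) K.coset_eq by simp
    then obtain u where u: "u \<in> K" "a' = a \<otimes> u" by (auto simp: l_coset_def)
    then have uc: "u \<in> carrier A" using K.subset by auto
    have "apply_symbol quot e ((I #> a) \<otimes>\<^bsub>quot\<^esub> (I #> u)) (I #> v)
        = apply_symbol quot e (I #> a) (I #> v)"
      using a uc v van[OF u(1)] False by (intro Q.apply_symbol_mult_vanishing) auto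
    then show ?thesis
      using a uc v u apply_symbol_quot[of _ v e] by (simp add: mult_quot)
  qed
qed

end

section \<open>The annihilator series and commutator words\<close>

context skew_brace
begin

lemma Ann_ideal: "brace_ideal A (Ann A n)"
proof (induction n)
  case 0
  have "subgroup {\<one>} (circ_monoid A)"
    using circ.triv_subgroup by (simp add: circ_one_eq_one)
  then show ?case
    unfolding brace_ideal_def
    using one_is_normal circ.one_is_normal by (auto simp: r_coset_def circ_one_eq_one)
next
  case (Suc n)
  interpret skew_brace_ideal A "Ann A n" using Suc by unfold_locales
  show ?case using ideal_preimage[OF Q.annihilator_ideal] by simp
qed

lemma Ann_skew_brace_ideal: "skew_brace_ideal A (Ann A n)"
  by unfold_locales (rule Ann_ideal)

lemma Ann_subset: "Ann A n \<subseteq> carrier A"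
  by (cases n) auto

lemma mem_Ann_Suc_iff:
  "u \<in> Ann A (Suc n) \<longleftrightarrow>
     u \<in> carrier A \<and> (\<forall>e. \<forall>b \<in> carrier A. apply_symbol A e u b \<in> Ann A n)"
proof -
  interpret skew_brace_ideal A "Ann A n" by (rule Ann_skew_brace_ideal)
  show ?thesis
    unfolding Ann.simps Q.mem_annihilator_iff carrier_quot
    by (auto simp: quot_symbols_vanish_iff)
qed

end

primrec swap_symbol :: "comm_symbol \<Rightarrow> comm_symbol" where
  "swap_symbol Gamma = Gamma_bar"
| "swap_symbol Gamma_bar = Gamma"
| "swap_symbol Star = Star_bar"
| "swap_symbol Star_bar = Star"

lemma apply_swap_symbol: "apply_symbol A (swap_symbol e) a b = apply_symbol A e b a"
  by (cases e) auto

text \<open>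
  A word splits at any position: the right part, evaluated first, supplies the last argument of the
  left part.
\<close>

lemma word_value_append:
  "length as = length m \<Longrightarrow> word_value A (m @ m') (as @ bs) = word_value A m (as @ [word_value A m' bs])"
  by (induction m arbitrary: as) (auto simp: length_Suc_conv)

text \<open>
  The case distinction between degree zero and positive degree disappears if the empty word is
  allowed.
\<close>

lemma word_values_eq:
  "word_values A r =
     {word_value A m as | m as. length m = r \<and> length as = Suc r \<and> set as \<subseteq> carrier A}"
proof (cases r)
  case 0
  have "x \<in> {word_value A m as | m as. length m = 0 \<and> length as = Suc 0 \<and> set as \<subseteq> carrier A}"
    if "x \<in> carrier A" for x
    using that by (intro CollectI exI[of _ "[]"] exI[of _ "[x]"]) simp
  moreover have "word_value A m as \<in> carrier A"
    if "length m = 0" "length as = Suc 0" "set as \<subseteq> carrier A" for m as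
    using that by (auto simp: length_Suc_conv)
  ultimately show ?thesis unfolding 0 word_values.simps by blast
qed (simp cong: conj_cong)

context skew_brace
begin

lemma word_value_closed:
  "\<lbrakk>length as = Suc (length m); set as \<subseteq> carrier A\<rbrakk> \<Longrightarrow> word_value A m as \<in> carrier A"
  by (induction m arbitrary: as) (auto simp: length_Suc_conv)

text \<open>
  Membership in \<open>Ann k\<close> is a nested condition \<open>\<epsilon>\<^sub>k(\<dots> \<epsilon>\<^sub>1(x, b\<^sub>1) \<dots>, b\<^sub>k) = 1\<close>; exchanging the
  arguments of every symbol turns the left-hand side into a word with last argument \<open>x\<close>.
\<close>

lemma mem_Ann_iff_words:
  "x \<in> Ann A k \<longleftrightarrow> x \<in> carrier A \<and>
     (\<forall>m as. length m = k \<and> length as = k \<and> set as \<subseteq> carrier A \<longrightarrow> word_value A m (as @ [x]) = \<one>)"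
proof (induction k arbitrary: x)
  case 0
  then show ?case by auto
next
  case (Suc k)
  show ?case
  proof (intro iffI conjI allI impI)
    assume x: "x \<in> Ann A (Suc k)"
    show "x \<in> carrier A" using x Ann_subset by auto
    fix m :: "comm_symbol list" and as assume *: "length m = Suc k \<and> length as = Suc k \<and> set as \<subseteq> carrier A"
    obtain m' e where m: "m = m' @ [e]" "length m' = k" using * by (auto simp: length_Suc_conv_rev)
    obtain as' b where as: "as = as' @ [b]" "length as' = k" using * by (auto simp: length_Suc_conv_rev)
    have b: "b \<in> carrier A" "set as' \<subseteq> carrier A" using * as(1) by auto
    then have "apply_symbol A (swap_symbol e) x b \<in> Ann A k"
      using x unfolding mem_Ann_Suc_iff by blast
    then have "word_value A m' (as' @ [apply_symbol A e b x]) = \<one>"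
      unfolding apply_swap_symbol using Suc.IH m(2) as(2) b(2) by blast
    then show "word_value A m (as @ [x]) = \<one>"
      using m as word_value_append[of as' m' A "[e]" "[b, x]"] by simp
  next
    assume *: "x \<in> carrier A \<and> (\<forall>m as. length m = Suc k \<and> length as = Suc k \<and>
      set as \<subseteq> carrier A \<longrightarrow> word_value A m (as @ [x]) = \<one>)"
    show "x \<in> Ann A (Suc k)"
      unfolding mem_Ann_Suc_iff
    proof (intro conjI allI ballI)
      show x: "x \<in> carrier A" using * by simp
      fix e b assume b: "b \<in> carrier A"
      show "apply_symbol A e x b \<in> Ann A k"
        unfolding Suc.IH
      proof (intro conjI allI impI)
        show "apply_symbol A e x b \<in> carrier A" using x b by simp
        fix m :: "comm_symbol list" and as assume m: "length m = k \<and> length as = k \<and> set as \<subseteq> carrier A"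
        have "word_value A (m @ [swap_symbol e]) ((as @ [b]) @ [x]) = \<one>"
          using m b by (intro *[THEN conjunct2, rule_format]) auto
        then show "word_value A m (as @ [apply_symbol A e x b]) = \<one>"
          using m word_value_append[of as m A "[swap_symbol e]" "[b, x]"]
          by (simp add: apply_swap_symbol)
      qed
    qed
  qed
qed

text \<open>
  The second argument of a symbol is the first argument of the exchanged symbol, so this is the
  congruence lemma with \<open>K = Ann (k + 1)\<close> and \<open>I = Ann k\<close>, whose hypothesis then holds for every
  second argument.
\<close>

lemma apply_symbol_Ann_cong:
  assumes "a \<in> carrier A" "v \<in> carrier A" "v' \<in> carrier A"
    and "Ann A (Suc k) #> v = Ann A (Suc k) #> v'"
  shows "Ann A k #> apply_symbol A e a v = Ann A k #> apply_symbol A e a v'"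
proof -
  interpret skew_brace_ideal A "Ann A k" by (rule Ann_skew_brace_ideal)
  have "apply_symbol A e u a \<in> Ann A k" if "u \<in> Ann A (Suc k)" for e u
    using that assms(1) unfolding mem_Ann_Suc_iff by blast
  then show ?thesis
    using apply_symbol_coset_cong[OF Ann_ideal assms(2,3,4,1), of "swap_symbol e"]
    unfolding apply_swap_symbol by blast
qed

text \<open>
  The induction on \<open>m\<close> prepends a symbol and thereby moves one step down the annihilator series.  The
  inner value \<open>v\<close> lies in \<open>S (r - 1)\<close> for \<open>r = length m + 1\<close>, which is the instance of the
  hypothesis that controls the outermost argument.
\<close>

lemma word_value_cong:
  assumes cond: "\<And>e r u v. \<lbrakk>1 \<le> r; r \<le> n; u \<in> Ann A n; v \<in> word_values A (r - 1)\<rbrakk> \<Longrightarrow>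
       apply_symbol A e u v \<in> Ann A (n - r)"
  shows "\<lbrakk>length m \<le> n; length as = Suc (length m); set as \<subseteq> carrier A;
      length as' = Suc (length m); set as' \<subseteq> carrier A;
      map (\<lambda>a. Ann A n #> a) as = map (\<lambda>a. Ann A n #> a) as'\<rbrakk> \<Longrightarrow>
    Ann A (n - length m) #> word_value A m as = Ann A (n - length m) #> word_value A m as'"
proof (induction m arbitrary: as as')
  case Nil
  then show ?case by (auto simp: length_Suc_conv)
next
  case (Cons e m)
  define k where "k = n - Suc (length m)"
  have k: "n - length m = Suc k" using Cons.prems(1) by (simp add: k_def)
  obtain a bs where as: "as = a # bs" using Cons.prems by (cases as) auto
  obtain a' bs' where as': "as' = a' # bs'" using Cons.prems by (cases as') auto
  define v v' where "v = word_value A m bs" and "v' = word_value A m bs'"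
  have [simp]: "a \<in> carrier A" "a' \<in> carrier A" "v \<in> carrier A" "v' \<in> carrier A"
    using Cons.prems as as' word_value_closed by (auto simp: v_def v'_def)
  have v: "v \<in> word_values A (length m)"
    unfolding word_values_eq v_def using Cons.prems as by fastforce
  have IH: "Ann A (Suc k) #> v = Ann A (Suc k) #> v'"
    using Cons.IH[of bs bs'] Cons.prems as as' unfolding v_def v'_def k by simp
  interpret skew_brace_ideal A "Ann A k" by (rule Ann_skew_brace_ideal)
  have "Ann A k #> apply_symbol A e a v = Ann A k #> apply_symbol A e a' v"
    by (rule apply_symbol_coset_cong[OF Ann_ideal[of n]])
      (use Cons.prems as as' v cond[of "Suc (length m)" _ v] in \<open>auto simp: k_def\<close>)
  also have "\<dots> = Ann A k #> apply_symbol A e a' v'"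
    by (rule apply_symbol_Ann_cong[OF _ _ _ IH]) auto
  finally show ?case by (simp add: as as' v_def v'_def k_def)
qed

text \<open>
  A map on tuples of cosets is obtained by choosing representatives.  Its values lie in the required
  subgroup because they are themselves word values of degree \<open>n\<close>.
\<close>

lemma phi_well_defined_iff:
  assumes "length m = n"
  shows "phi_well_defined A n m \<longleftrightarrow>
    (\<forall>as as'. length as = n + 1 \<and> set as \<subseteq> carrier A \<and> length as' = n + 1 \<and> set as' \<subseteq> carrier A \<and>
       map (\<lambda>a. Ann A n #> a) as = map (\<lambda>a. Ann A n #> a) as' \<longrightarrow>
       word_value A m as = word_value A m as')"
    (is "_ \<longleftrightarrow> ?R")
proof
  assume "phi_well_defined A n m"
  then obtain \<phi> where "\<forall>as. length as = n + 1 \<and> set as \<subseteq> carrier A \<longrightarrow>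
      \<phi> (map (\<lambda>a. Ann A n #> a) as) = word_value A m as"
    unfolding phi_well_defined_def by blast
  then show ?R by metis
next
  assume R: ?R
  interpret skew_brace_ideal A "Ann A n" by (rule Ann_skew_brace_ideal)
  define rep where "rep = inv_into (carrier A) (\<lambda>a. Ann A n #> a)"
  have rep: "rep c \<in> carrier A" "Ann A n #> rep c = c" if "c \<in> carrier quot" for c
    using that inv_into_into[of c "\<lambda>a. Ann A n #> a" "carrier A"]
      f_inv_into_f[of c "\<lambda>a. Ann A n #> a" "carrier A"]
    unfolding rep_def carrier_quot by blast+
  let ?\<phi> = "\<lambda>cs. word_value A m (map rep cs)"
  show "phi_well_defined A n m"
    unfolding phi_well_defined_def
  proof (rule bexI[of _ ?\<phi>], intro allI impI)
    fix as assume as: "length as = n + 1 \<and> set as \<subseteq> carrier A"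
    then show "?\<phi> (map (\<lambda>a. Ann A n #> a) as) = word_value A m as"
      by (intro R[rule_format]) (auto simp: rep subset_iff)
  next
    show "?\<phi> \<in> {cs. length cs = n + 1 \<and> set cs \<subseteq> carrier quot} \<rightarrow> word_subgroup A n"
    proof
      fix cs assume cs: "cs \<in> {cs. length cs = n + 1 \<and> set cs \<subseteq> carrier quot}"
      then have "set (map rep cs) \<subseteq> carrier A" by (auto simp: rep subset_iff)
      then have "?\<phi> cs \<in> {word_value A m as | m as.
          n \<le> length m \<and> length as = length m + 1 \<and> set as \<subseteq> carrier A}"
        using cs assms by (intro CollectI exI[of _ m] exI[of _ "map rep cs"]) auto
      then show "?\<phi> cs \<in> word_subgroup A n"
        unfolding word_subgroup_def by (rule generate.incl)
    qed
  qed
qed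

end

section \<open>The characterisation\<close>

theorem corollary4p9:
  fixes A :: "('a, 'm) skew_brace_scheme" and n :: nat
  assumes "skew_brace A" and "1 \<le> n"
  shows "class_I n A \<longleftrightarrow>
    (\<forall>e r u v. 1 \<le> r \<and> r \<le> n \<and> u \<in> Ann A n \<and> v \<in> word_values A (r - 1) \<longrightarrow>
       apply_symbol A e u v \<in> Ann A (n - r))"
    (is "_ \<longleftrightarrow> ?cond")
proof
  interpret skew_brace A by fact
  interpret N: skew_brace_ideal A "Ann A n" by (rule Ann_skew_brace_ideal)
  assume I: "class_I n A"
  show ?cond
  proof (intro allI impI, elim conjE)
    fix e r u v
    assume r: "1 \<le> r" "r \<le> n" and u: "u \<in> Ann A n" and v: "v \<in> word_values A (r - 1)"
    obtain m' bs where v_eq: "v = word_value A m' bs"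
      and m': "length m' = r - 1" "length bs = r" "set bs \<subseteq> carrier A"
      using v r unfolding word_values_eq by auto
    interpret R: skew_brace_ideal A "Ann A (n - r)" by (rule Ann_skew_brace_ideal)
    have vc: "v \<in> carrier A" using v_eq m' r word_value_closed[of bs m'] by simp
    have uc: "u \<in> carrier A" using u Ann_subset by auto
    show "apply_symbol A e u v \<in> Ann A (n - r)"
      unfolding mem_Ann_iff_words
    proof (intro conjI allI impI)
      show "apply_symbol A e u v \<in> carrier A" using uc vc by simp
      fix m :: "comm_symbol list" and as
      assume m: "length m = n - r \<and> length as = n - r \<and> set as \<subseteq> carrier A"
      let ?w = "m @ e # m'"
      have split_word: "word_value A ?w (as @ x # bs) = word_value A m (as @ [apply_symbol A e x v])" for x
        using m word_value_append[of as m A "e # m'" "x # bs"] by (simp add: v_eq)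
      have "Ann A n #>\<^bsub>A\<^esub> u = Ann A n #>\<^bsub>A\<^esub> \<one>\<^bsub>A\<^esub>"
        using N.proj_eq_one_iff[OF uc] N.proj_eq_one_iff[OF one_closed] u
          subgroup.one_closed[OF N.subgroup_axioms] by simp
      then have "word_value A ?w (as @ u # bs) = word_value A ?w (as @ \<one>\<^bsub>A\<^esub> # bs)"
        using I m m' r uc phi_well_defined_iff[of ?w n] unfolding class_I_def by auto
      also have "\<dots> = word_value A m (as @ [\<one>\<^bsub>A\<^esub>])"
        using split_word vc by simp
      also have "\<dots> = \<one>\<^bsub>A\<^esub>"
        using m subgroup.one_closed[OF R.subgroup_axioms] mem_Ann_iff_words by blast
      finally show "word_value A m (as @ [apply_symbol A e u v]) = \<one>\<^bsub>A\<^esub>"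
        using split_word by simp
    qed
  qed
next
  interpret skew_brace A by fact
  assume cond: ?cond
  show "class_I n A"
    unfolding class_I_def
  proof (intro conjI allI impI)
    show "skew_brace A" by fact
    fix m :: "comm_symbol list" assume m: "length m = n"
    show "phi_well_defined A n m"
      unfolding phi_well_defined_iff[OF m]
    proof (intro allI impI)
      fix as as' assume *: "length as = n + 1 \<and> set as \<subseteq> carrier A \<and>
        length as' = n + 1 \<and> set as' \<subseteq> carrier A \<and>
        map (\<lambda>a. Ann A n #>\<^bsub>A\<^esub> a) as = map (\<lambda>a. Ann A n #>\<^bsub>A\<^esub> a) as'"
      then have "Ann A 0 #>\<^bsub>A\<^esub> word_value A m as = Ann A 0 #>\<^bsub>A\<^esub> word_value A m as'"
        using word_value_cong[of n m as as'] cond m by simp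
      then show "word_value A m as = word_value A m as'"
        using * m word_value_closed[of as m] word_value_closed[of as' m]
        by (simp add: r_coset_def)
    qed
  qed
qed

end
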